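(* Let $(\mathcal{R},\partial,\int)$ be a commutative integro-differential ring and let $L=\partial^n+\sum_{i=0}^{n-1}a_i\cdot\partial^i\in\mathcal{R}\langle\partial,\int,\mathrm{E}\rangle$, $n\ge1$, with $a_0,\dots,a_{n-1}\in\mathcal{R}$. Assume that $z_1,\dots,z_n\in\mathcal{R}$ are such that $Lz_i=0$ for all $i$ and $w:=W(z_1,\dots,z_n)$ has a multiplicative inverse $\frac1w\in\mathcal{R}$. Then, with $$H:=\sum_{i=1}^n(-1)^{n-i}z_i\cdot\textstyle\int\cdot\displaystyle\frac{W(z_1,\dots,z_{i-1},z_{i+1},\dots,z_n)}{w},$$ we have $L\cdot H=1$ in $\mathcal{R}\langle\partial,\int,\mathrm{E}\rangle$.
   Context: Rings are unital and nonzero, of arbitrary characteristic. A derivation on a ring $\mathcal{R}$ is an additive map $\partial$ with $\partial(fg)=(\partial f)g+f\,\partial g$; $\mathcal{C}=\{f\in\mathcal{R}:\partial f=0\}$ is the ring of constants. An integro-differential ring $(\mathcal{R},\partial,\int)$ is a differential ring together with a $\mathcal{C}$-linear map $\int\colon\mathcal{R}\to\mathcal{R}$ satisfying $\partial\int f=f$ for all $f$. Its induced evaluation is $\mathrm{E}f:=f-\int\partial f\in\mathcal{C}$. The ring of integro-differential operators $\mathcal{R}\langle\partial,\int,\mathrm{E}\rangle$ is the (noncommutative unital) ring extension of $\mathcal{R}$ generated by indeterminates $\partial,\int,\mathrm{E}$ that commute with all elements of $\mathcal{C}$, subject to the identities, for all $f\in\mathcal{R}$: $\partial\cdot f=f\cdot\partial+\partial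 f$, $\ \partial\cdot\int=1$, $\ \int\cdot\partial=1-\mathrm{E}$, $\ \partial\cdot f\cdot\mathrm{E}=\partial f\cdot\mathrm{E}$, $\ \int\cdot f\cdot\mathrm{E}=\int f\cdot\mathrm{E}$, $\ \mathrm{E}\cdot f\cdot\mathrm{E}=\mathrm{E}f\cdot\mathrm{E}$. Here the dot denotes multiplication of operators, whereas $\partial f,\int f,\mathrm{E}f$ without dot denote elements of $\mathcal{R}$. This ring acts on $\mathcal{R}$ (elements of $\mathcal{R}$ as multiplication operators, $\partial,\int,\mathrm{E}$ as the corresponding maps), and $Lz$ denotes this action. The Wronskian of $f_1,\dots,f_k\in\mathcal{R}$ is $W(f_1,\dots,f_k):=\det\bigl((\partial^{i-1}f_j)_{i,j=1,\dots,k}\bigr)$, with the empty Wronskian ($k=0$) equal to $1$. *)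

theory Defs
  imports "Jordan_Normal_Form.Determinant"
begin

section \<open>Commutative integro-differential rings\<close>

class comm_integro_differential_ring = comm_ring_1 +
  fixes der :: "'a \<Rightarrow> 'a"
    and itg :: "'a \<Rightarrow> 'a"
  assumes der_add: "der (f + g) = der f + der g"
    and der_mult: "der (f * g) = der f * g + f * der g"
    and itg_add: "itg (f + g) = itg f + itg g"
    and itg_mult_const: "der c = 0 \<Longrightarrow> itg (c * f) = c * itg f"
    and der_itg: "der (itg f) = f"
begin

definition evl :: "'a \<Rightarrow> 'a" where
  "evl f = f - itg (der f)"

lemma der_0: "der 0 = 0"
  using der_add[of 0 0] by simp

lemma der_minus: "der (- f) = - der f"
  using der_add[of f "- f"] der_0 by (simp add: eq_neg_iff_add_eq_0 add.commute)

lemma der_diff: "der (f - g) = der f - der g"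
  using der_add[of f "- g"] der_minus by simp

lemma itg_0: "itg 0 = 0"
  using itg_add[of 0 0] by simp

lemma itg_minus: "itg (- f) = - itg f"
  using itg_add[of f "- f"] itg_0 by (simp add: eq_neg_iff_add_eq_0 add.commute)

lemma itg_diff: "itg (f - g) = itg f - itg g"
  using itg_add[of f "- g"] itg_minus by simp

lemma der_evl: "der (evl f) = 0"
  by (simp add: evl_def der_diff der_itg)

lemma evl_add: "evl (f + g) = evl f + evl g"
  by (simp add: evl_def der_add itg_add algebra_simps)

lemma evl_mult_const: "der c = 0 \<Longrightarrow> evl (c * f) = c * evl f"
  by (simp add: evl_def der_mult itg_mult_const right_diff_distrib)

end

definition wronskian :: "'a::comm_integro_differential_ring list \<Rightarrow> 'a" where
  "wronskian fs =
     det (mat (length fs) (length fs) (\<lambda>(i, j). (der ^^ i) (fs ! j)))"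


section \<open>The ring of integro-differential operators\<close>

text \<open>
  The ring is built from its presentation: noncommutative ring expressions over the
  elements of the coefficient ring and the three indeterminates, modulo the least
  congruence that contains the ring axioms, makes \<open>Coef\<close> a unital ring homomorphism,
  and contains the defining identities. The zero and the unit are \<open>Coef 0\<close> and
  \<open>Coef 1\<close>.
\<close>

datatype 'a idexpr =
    Coef 'a
  | DerX
  | ItgX
  | EvlX
  | Plus "'a idexpr" "'a idexpr"
  | Neg "'a idexpr"
  | Times "'a idexpr" "'a idexpr"

inductive ideq ::
  "'a::comm_integro_differential_ring idexpr \<Rightarrow> 'a idexpr \<Rightarrow> bool"
where
  refl: "ideq x x"
| sym: "ideq x y \<Longrightarrow> ideq y x"
| trans: "ideq x y \<Longrightarrow> ideq y z \<Longrightarrow> ideq x z"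
| Plus_cong: "ideq x x' \<Longrightarrow> ideq y y' \<Longrightarrow> ideq (Plus x y) (Plus x' y')"
| Neg_cong: "ideq x x' \<Longrightarrow> ideq (Neg x) (Neg x')"
| Times_cong: "ideq x x' \<Longrightarrow> ideq y y' \<Longrightarrow> ideq (Times x y) (Times x' y')"
  \<comment> \<open>unital ring axioms\<close>
| Plus_assoc: "ideq (Plus (Plus x y) z) (Plus x (Plus y z))"
| Plus_comm: "ideq (Plus x y) (Plus y x)"
| Plus_zero: "ideq (Plus (Coef 0) x) x"
| Plus_Neg: "ideq (Plus (Neg x) x) (Coef 0)"
| Times_assoc: "ideq (Times (Times x y) z) (Times x (Times y z))"
| One_Times: "ideq (Times (Coef 1) x) x"
| Times_One: "ideq (Times x (Coef 1)) x"
| distrib_right: "ideq (Times (Plus x y) z) (Plus (Times x z) (Times y z))"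
| distrib_left: "ideq (Times x (Plus y z)) (Plus (Times x y) (Times x z))"
  \<comment> \<open>the operations on coefficients are those of the coefficient ring\<close>
| Coef_add: "ideq (Coef (f + g)) (Plus (Coef f) (Coef g))"
| Coef_mult: "ideq (Coef (f * g)) (Times (Coef f) (Coef g))"
  \<comment> \<open>the indeterminates commute with constants\<close>
| Der_const: "der c = 0 \<Longrightarrow> ideq (Times DerX (Coef c)) (Times (Coef c) DerX)"
| Itg_const: "der c = 0 \<Longrightarrow> ideq (Times ItgX (Coef c)) (Times (Coef c) ItgX)"
| Evl_const: "der c = 0 \<Longrightarrow> ideq (Times EvlX (Coef c)) (Times (Coef c) EvlX)"
  \<comment> \<open>the defining identities\<close>
| Der_Coef: "ideq (Times DerX (Coef f)) (Plus (Times (Coef f) DerX) (Coef (der f)))"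
| Der_Itg: "ideq (Times DerX ItgX) (Coef 1)"
| Itg_Der: "ideq (Times ItgX DerX) (Plus (Coef 1) (Neg EvlX))"
| Der_Coef_Evl: "ideq (Times DerX (Times (Coef f) EvlX)) (Times (Coef (der f)) EvlX)"
| Itg_Coef_Evl: "ideq (Times ItgX (Times (Coef f) EvlX)) (Times (Coef (itg f)) EvlX)"
| Evl_Coef_Evl: "ideq (Times EvlX (Times (Coef f) EvlX)) (Times (Coef (evl f)) EvlX)"

primrec apply_expr ::
  "'a::comm_integro_differential_ring idexpr \<Rightarrow> 'a \<Rightarrow> 'a"
where
  "apply_expr (Coef f) = (\<lambda>u. f * u)"
| "apply_expr DerX = der"
| "apply_expr ItgX = itg"
| "apply_expr EvlX = evl"
| "apply_expr (Plus x y) = (\<lambda>u. apply_expr x u + apply_expr y u)"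
| "apply_expr (Neg x) = (\<lambda>u. - apply_expr x u)"
| "apply_expr (Times x y) = (\<lambda>u. apply_expr x (apply_expr y u))"

lemma apply_expr_add: "apply_expr x (u + v) = apply_expr x u + apply_expr x v"
  by (induction x arbitrary: u v)
     (simp_all add: der_add itg_add evl_add algebra_simps)

lemma apply_expr_cong: "ideq x y \<Longrightarrow> apply_expr x = apply_expr y"
proof (induction rule: ideq.induct)
  case (Itg_Coef_Evl f)
  have "itg (f * evl u) = itg f * evl u" for u
    using itg_mult_const[OF der_evl, of u f] by (simp add: mult.commute)
  then show ?case by (simp add: fun_eq_iff)
next
  case (Der_Coef_Evl f)
  then show ?case by (simp add: fun_eq_iff der_mult der_evl)
next
  case (Evl_Coef_Evl f)
  have "evl (f * evl u) = evl f * evl u" for u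
    using evl_mult_const[OF der_evl, of u f] by (simp add: mult.commute)
  then show ?case by (simp add: fun_eq_iff)
qed (simp_all add: fun_eq_iff apply_expr_add der_mult itg_mult_const
       evl_mult_const der_itg evl_def[abs_def] algebra_simps)

quotient_type (overloaded) 'a idop =
  "'a::comm_integro_differential_ring idexpr" / ideq
proof (intro equivpI reflpI sympI transpI)
  show "ideq x x" for x :: "'a idexpr" by (rule ideq.refl)
  show "ideq y x" if "ideq x y" for x y :: "'a idexpr" using that by (rule ideq.sym)
  show "ideq x z" if "ideq x y" "ideq y z" for x y z :: "'a idexpr"
    using that by (rule ideq.trans)
qed

lift_definition coef :: "'a::comm_integro_differential_ring \<Rightarrow> 'a idop" is Coef .

lift_definition Der :: "'a::comm_integro_differential_ring idop" is DerX .

lift_definition Itg :: "'a::comm_integro_differential_ring idop" is ItgX .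

lift_definition Evl :: "'a::comm_integro_differential_ring idop" is EvlX .

text \<open>The action of operators on the coefficient ring.\<close>

lift_definition act :: "'a::comm_integro_differential_ring idop \<Rightarrow> 'a \<Rightarrow> 'a" is apply_expr
  by (rule apply_expr_cong)

instantiation idop :: (comm_integro_differential_ring) ring_1
begin

lift_definition zero_idop :: "'a idop" is "Coef 0" .
lift_definition one_idop :: "'a idop" is "Coef 1" .
lift_definition plus_idop :: "'a idop \<Rightarrow> 'a idop \<Rightarrow> 'a idop" is Plus
  by (rule ideq.Plus_cong)
lift_definition uminus_idop :: "'a idop \<Rightarrow> 'a idop" is Neg
  by (rule ideq.Neg_cong)
lift_definition minus_idop :: "'a idop \<Rightarrow> 'a idop \<Rightarrow> 'a idop" is "\<lambda>x y. Plus x (Neg y)"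
  by (intro ideq.Plus_cong ideq.Neg_cong)
lift_definition times_idop :: "'a idop \<Rightarrow> 'a idop \<Rightarrow> 'a idop" is Times
  by (rule ideq.Times_cong)

instance
proof
  show "(0 :: 'a idop) \<noteq> 1"
  proof transfer
    have "apply_expr (Coef (0::'a)) 1 \<noteq> apply_expr (Coef 1) 1" by simp
    then show "\<not> ideq (Coef (0::'a)) (Coef 1)" using apply_expr_cong by metis
  qed
qed (transfer, rule ideq.Plus_assoc ideq.Plus_comm ideq.Plus_zero ideq.Plus_Neg
       ideq.Times_assoc ideq.One_Times ideq.Times_One ideq.distrib_right
       ideq.distrib_left ideq.refl)+

end

lemma coef_0: "coef 0 = 0"
  by transfer (rule ideq.refl)

lemma coef_1: "coef 1 = 1"
  by transfer (rule ideq.refl)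

lemma coef_add: "coef (f + g) = coef f + coef g"
  by transfer (rule ideq.Coef_add)

lemma coef_mult: "coef (f * g) = coef f * coef g"
  by transfer (rule ideq.Coef_mult)

lemma Der_coef: "Der * coef f = coef f * Der + coef (der f)"
  by transfer (rule ideq.Der_Coef)

lemma Der_Itg: "Der * Itg = 1"
  by transfer (rule ideq.Der_Itg)

lemma Itg_Der: "Itg * Der = 1 - Evl"
  by transfer (rule ideq.Itg_Der)

lemma Der_coef_Evl: "Der * (coef f * Evl) = coef (der f) * Evl"
  by transfer (rule ideq.Der_Coef_Evl)

lemma Itg_coef_Evl: "Itg * (coef f * Evl) = coef (itg f) * Evl"
  by transfer (rule ideq.Itg_Coef_Evl)

lemma Evl_coef_Evl: "Evl * (coef f * Evl) = coef (evl f) * Evl"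
  by transfer (rule ideq.Evl_Coef_Evl)

lemma coef_const_commute:
  assumes "der c = 0"
  shows "Der * coef c = coef c * Der"
    and "Itg * coef c = coef c * Itg"
    and "Evl * coef c = coef c * Evl"
proof -
  show "Der * coef c = coef c * Der"
    using assms by transfer (rule ideq.Der_const)
  show "Itg * coef c = coef c * Itg"
    using assms by transfer (rule ideq.Itg_const)
  show "Evl * coef c = coef c * Evl"
    using assms by transfer (rule ideq.Evl_const)
qed

lemma act_simps:
  "act (coef f) u = f * u"
  "act Der u = der u"
  "act Itg u = itg u"
  "act Evl u = evl u"
  "act 0 u = 0"
  "act 1 u = u"
  "act (x + y) u = act x u + act y u"
  "act (- x) u = - act x u"
  "act (x - y) u = act x u - act y u"
  "act (x * y) u = act x (act y u)"
  by (transfer, simp)+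

text \<open>The coefficient ring embeds, so the quotient is a ring extension of it.\<close>

lemma inj_coef: "inj coef"
  by (rule injI) (metis act_simps(1) mult.right_neutral)

end

(* Variation of constants at the operator level. Expanding the Wronskian of z_1, ..., z_n along its
   last row, the weights u_i = (-1)^(n-i) W(.., no z_i, ..) / w satisfy sum_i z_i^(k) u_i = 0 for
   k < n - 1 (two equal rows) and = 1 for k = n - 1. Hence, when a power of Der is pushed through
   H = sum_i z_i Itg u_i, the terms produced by Der * Itg = 1 vanish up to order n - 1 and add up to 1
   at order n, so L * H = sum_i (L z_i) Itg u_i + 1 = 1. *)
theory Submission
  imports Defs
begin

lemma coef_minus: "coef (- f) = - coef f"
  using coef_add[of f "- f"] by (simp add: coef_0 eq_neg_iff_add_eq_0 add.commute)

lemma coef_sum: "coef (sum f A) = (\<Sum>i\<in>A. coef (f i))"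
  by (induction A rule: infinite_finite_induct) (simp_all add: coef_0 coef_add)

lemma coef_minus_one_power: "coef ((- 1) ^ k) = (- 1) ^ k"
  by (induction k) (simp_all add: coef_1 coef_minus)

text \<open>Operators do not commute in general, but signs are central; this carries the sign of a
  summand of \<open>H\<close> past \<open>coef\<close> and \<open>Itg\<close> to the weight on the
  right.\<close>

lemma minus_one_power_commute: "(- 1) ^ k * x = x * (- 1) ^ k" for x :: "'a::ring_1"
  by (induction k) simp_all

lemma act_Der_power: "act (Der ^ k) u = (der ^^ k) u"
  by (induction k) (simp_all add: act_simps)

lemma act_sum: "act (sum f A) u = (\<Sum>i\<in>A. act (f i) u)"
  by (induction A rule: infinite_finite_induct) (simp_all add: act_simps)

text \<open>Laplace expansion of the Wronskian matrix whose last row is overwritten by the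
  derivatives of order \<open>k\<close>: for \<open>k = m\<close> nothing changes, while for
  \<open>k < m\<close> rows \<open>k\<close> and \<open>m\<close> coincide.\<close>

lemma wronskian_expand_last_row:
  fixes fs :: "'a::comm_integro_differential_ring list"
  assumes len: "length fs = Suc m" and "k \<le> m"
  shows "(\<Sum>j<Suc m. (der ^^ k) (fs ! j) * ((- 1) ^ (m + j) * wronskian (take j fs @ drop (Suc j) fs)))
    = (if k = m then wronskian fs else 0)"
proof -
  define A where
    "A = mat (Suc m) (Suc m) (\<lambda>(i, j). (der ^^ (if i = m then k else i)) (fs ! j))"
  have A: "A \<in> carrier_mat (Suc m) (Suc m)"
    by (simp add: A_def)
  \<comment> \<open>Deleting row \<open>m\<close> removes the only row that depends on
    \<open>k\<close>, so the same cofactors serve every \<open>k\<close>.\<close>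
  have minor: "det (mat_delete A m j) = wronskian (take j fs @ drop (Suc j) fs)"
    if "j < Suc m" for j
  proof -
    have "mat_delete A m j = mat m m (\<lambda>(i, l). (der ^^ i) ((take j fs @ drop (Suc j) fs) ! l))"
      using that len by (auto simp: mat_delete_def A_def nth_append min_def intro!: eq_matI)
    moreover have "length (take j fs @ drop (Suc j) fs) = m"
      using that len by simp
    ultimately show ?thesis
      by (simp add: wronskian_def)
  qed
  have entry: "A $$ (m, j) = (der ^^ k) (fs ! j)" if "j < Suc m" for j
    using that by (simp add: A_def)
  have "det A = (\<Sum>j<Suc m. A $$ (m, j) * cofactor A m j)"
    by (rule laplace_expansion_row[OF A]) simp
  also have "\<dots> = (\<Sum>j<Suc m. (der ^^ k) (fs ! j) *
      ((- 1) ^ (m + j) * wronskian (take j fs @ drop (Suc j) fs)))"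
    by (rule sum.cong) (simp_all add: cofactor_def minor entry)
  finally have expansion: "det A = \<dots>" .
  have "det A = (if k = m then wronskian fs else 0)"
  proof (cases "k = m")
    case True
    then have "A = mat (length fs) (length fs) (\<lambda>(i, j). (der ^^ i) (fs ! j))"
      by (auto simp: A_def len intro!: eq_matI)
    with True show ?thesis
      by (simp add: wronskian_def)
  next
    case False
    with \<open>k \<le> m\<close> have "det A = 0"
      by (intro det_identical_rows[OF A, of k m]) (auto simp: A_def)
    with False show ?thesis
      by simp
  qed
  with expansion show ?thesis
    by simp
qed

text \<open>The Leibniz rule moves \<open>Der\<close> past \<open>coef (y i)\<close>; the term where
  \<open>Der\<close> meets \<open>Itg\<close> loses its integral and becomes multiplication by
  \<open>y i * u i\<close>.\<close>

lemma Der_sum_coef_Itg_coef: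
  "Der * (\<Sum>i\<in>A. coef (y i) * Itg * coef (u i)) =
    (\<Sum>i\<in>A. coef (der (y i)) * Itg * coef (u i)) + coef (\<Sum>i\<in>A. y i * u i)"
proof -
  have "Der * (coef (y i) * Itg * coef (u i)) =
      coef (der (y i)) * Itg * coef (u i) + coef (y i * u i)" for i
  proof -
    have "Der * (coef (y i) * Itg * coef (u i)) = (Der * coef (y i)) * Itg * coef (u i)"
      by (simp add: mult.assoc)
    also have "\<dots> = coef (y i) * (Der * Itg) * coef (u i) + coef (der (y i)) * Itg * coef (u i)"
      by (simp only: Der_coef semiring_class.distrib_right mult.assoc)
    finally show ?thesis
      by (simp add: Der_Itg coef_mult)
  qed
  then show ?thesis
    by (simp add: sum_distrib_left sum.distrib coef_sum)
qed

text \<open>Induction on \<open>k\<close>: passing from order \<open>j\<close> to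
  \<open>j + 1\<close> leaves the residue of order \<open>j\<close>, so the \<open>k\<close>-th
  power meets only residues of order below \<open>k\<close>.\<close>

lemma Der_power_sum_coef_Itg_coef:
  assumes "\<And>j. j < k \<Longrightarrow> (\<Sum>i\<in>A. (der ^^ j) (y i) * u i) = 0"
  shows "Der ^ k * (\<Sum>i\<in>A. coef (y i) * Itg * coef (u i)) =
    (\<Sum>i\<in>A. coef ((der ^^ k) (y i)) * Itg * coef (u i))"
  using assms
proof (induction k)
  case (Suc k)
  then show ?case
    by (simp add: mult.assoc[of Der] Der_sum_coef_Itg_coef[where y = "\<lambda>i. (der ^^ k) (y i)"] coef_0)
qed simp

text \<open>Variation of constants for arbitrary weights \<open>u\<close> dual to the derivatives of
  the solutions; the Wronskian quotients are one such choice.\<close>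

lemma monic_operator_right_inverse:
  fixes y u :: "'b \<Rightarrow> 'a::comm_integro_differential_ring"
  assumes L: "L = Der ^ Suc m + (\<Sum>k<Suc m. coef (a k) * Der ^ k)"
    and kernel: "\<And>i. i \<in> A \<Longrightarrow> act L (y i) = 0"
    and orth: "\<And>k. k < m \<Longrightarrow> (\<Sum>i\<in>A. (der ^^ k) (y i) * u i) = 0"
    and unit: "(\<Sum>i\<in>A. (der ^^ m) (y i) * u i) = 1"
  shows "L * (\<Sum>i\<in>A. coef (y i) * Itg * coef (u i)) = 1"
proof -
  define H where "H = (\<Sum>i\<in>A. coef (y i) * Itg * coef (u i))"
  have low: "Der ^ k * H = (\<Sum>i\<in>A. coef ((der ^^ k) (y i)) * Itg * coef (u i))" if "k < Suc m" for k
    unfolding H_def using that by (intro Der_power_sum_coef_Itg_coef orth) simp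
  \<comment> \<open>The last differentiation produces the residue of order \<open>m\<close>, which
    is 1 by \<open>unit\<close>.\<close>
  have top: "Der ^ Suc m * H = (\<Sum>i\<in>A. coef ((der ^^ Suc m) (y i)) * Itg * coef (u i)) + 1"
    by (simp add: mult.assoc[of Der] low unit coef_1
        Der_sum_coef_Itg_coef[where y = "\<lambda>i. (der ^^ m) (y i)"])
  have "L * H = Der ^ Suc m * H + (\<Sum>k<Suc m. coef (a k) * (Der ^ k * H))"
    by (simp only: L semiring_class.distrib_right sum_distrib_right mult.assoc)
  also have "(\<Sum>k<Suc m. coef (a k) * (Der ^ k * H)) =
      (\<Sum>k<Suc m. \<Sum>i\<in>A. coef (a k * (der ^^ k) (y i)) * Itg * coef (u i))"
    by (intro sum.cong HOL.refl) (simp add: low sum_distrib_left coef_mult mult.assoc)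
  also have "\<dots> = (\<Sum>i\<in>A. coef (\<Sum>k<Suc m. a k * (der ^^ k) (y i)) * Itg * coef (u i))"
    by (subst sum.swap) (simp only: coef_sum sum_distrib_right)
  \<comment> \<open>For each \<open>i\<close>, the coefficients to the left of \<open>Itg\<close>
    assemble into the action of \<open>L\<close> on \<open>y i\<close>.\<close>
  finally have "L * H = (\<Sum>i\<in>A. coef (act L (y i)) * Itg * coef (u i)) + 1"
    by (simp only: top L act_simps act_sum act_Der_power coef_add semiring_class.distrib_right sum.distrib
        add.assoc add.commute[of 1])
  with kernel show ?thesis
    by (simp add: H_def coef_0)
qed

theorem theorem5p1:
  fixes n :: nat
    and a z :: "nat \<Rightarrow> 'a::comm_integro_differential_ring"
    and w w_inv :: 'a
    and L H :: "'a idop"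
  assumes "n \<ge> 1"
    and "L = Der ^ n + (\<Sum>i<n. coef (a i) * Der ^ i)"
    and "\<And>i. i \<in> {1..n} \<Longrightarrow> act L (z i) = 0"
    and "w = wronskian (map z [1..<n+1])"
    and "w * w_inv = 1"
    and "H = (\<Sum>i=1..n. (- 1) ^ (n - i) * coef (z i) * Itg *
                coef (wronskian (map z ([1..<i] @ [i+1..<n+1])) * w_inv))"
  shows "L * H = 1"
proof -
  obtain m where n: "n = Suc m"
    using \<open>n \<ge> 1\<close> by (cases n) auto
  define fs where "fs = map z [1..<n+1]"
  define W where "W j = wronskian (take j fs @ drop (Suc j) fs)" for j
  \<comment> \<open>Indices are shifted to start at 0: \<open>j\<close> stands for
    \<open>i - 1\<close> and \<open>m\<close> for \<open>n - 1\<close>. The sign is that of the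
    cofactor at \<open>(m, j)\<close>.\<close>
  define u where "u j = (- 1) ^ (m + j) * W j * w_inv" for j
  have fs_nth: "fs ! j = z (Suc j)" if "j < Suc m" for j
    using that by (simp add: fs_def n del: upt_Suc)
  have sums: "(\<Sum>j<Suc m. (der ^^ k) (z (Suc j)) * u j) = (if k = m then 1 else 0)"
    if "k \<le> m" for k
  proof -
    have "(\<Sum>j<Suc m. (der ^^ k) (z (Suc j)) * u j) =
        (\<Sum>j<Suc m. (der ^^ k) (fs ! j) * ((- 1) ^ (m + j) * W j)) * w_inv"
      unfolding sum_distrib_right by (rule sum.cong) (simp_all add: u_def fs_nth mult.assoc)
    also have "\<dots> = (if k = m then w else 0) * w_inv"
      using wronskian_expand_last_row[of fs m k] that
      by (simp add: W_def assms(4) fs_def n del: upt_Suc sum.lessThan_Suc)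
    finally show ?thesis
      using \<open>w * w_inv = 1\<close> by simp
  qed
  have summand: "(- 1) ^ (n - Suc j) * coef (z (Suc j)) * Itg *
        coef (wronskian (map z ([1..<Suc j] @ [Suc j+1..<n+1])) * w_inv) =
      coef (z (Suc j)) * Itg * coef (u j)" if "j < Suc m" for j
  proof -
    have "map z ([1..<Suc j] @ [Suc j+1..<n+1]) = take j fs @ drop (Suc j) fs"
      using that by (simp add: fs_def n take_map drop_map del: upt_Suc)
    \<comment> \<open>The exponents \<open>m + j\<close> and \<open>n - Suc j = m - j\<close> differ
      by \<open>2 * j\<close>.\<close>
    moreover have "(- 1) ^ (m + j) = ((- 1) ^ (n - Suc j) :: 'a)"
      using that by (simp add: n minus_one_power_iff)
    ultimately have "coef (u j) = (- 1) ^ (n - Suc j) *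
        coef (wronskian (map z ([1..<Suc j] @ [Suc j+1..<n+1])) * w_inv)"
      by (simp only: u_def W_def coef_mult coef_minus_one_power mult.assoc)
    then show ?thesis
      by (simp only: mult.assoc minus_one_power_commute)
  qed
  have "H = (\<Sum>j<Suc m. coef (z (Suc j)) * Itg * coef (u j))"
    unfolding assms(6) sum.atLeast1_atMost_eq[folded One_nat_def]
    by (intro sum.cong summand) (simp_all only: n lessThan_iff)
  moreover have "L * \<dots> = 1"
    using assms(2,3) sums
    by (intro monic_operator_right_inverse[of L m a]) (simp_all add: n del: sum.lessThan_Suc)
  ultimately show ?thesis
    by simp
qed

end
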